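(* For every sequence $\{q_n\}_{n\ge 1}$ of positive real numbers, the inequalities $$(i)\quad g_{n}<p_{n}\left(\frac{q_{n+1}-q_{n}+1}{q_{n}}\right)$$ and $$(ii)\quad \frac{p_{n+1}}{p_{n}}<\frac{q_{n+1}+1}{q_{n}}$$ hold for infinitely many values of $n$.
   Context: $p_n$ denotes the $n$th prime number, and $g_n=p_{n+1}-p_n$ is the $n$th prime gap. *)

theory Defs
  imports Complex_Main "HOL-Library.Infinite_Set" "HOL-Computational_Algebra.Primes"
begin

(* Indexing starts at 1 (nth_prime 1 = 2), whereas enumerate starts at 0.
   The value at n = 0 is junk. *)
definition nth_prime :: "nat \<Rightarrow> nat" where
  "nth_prime n = enumerate {p::nat. prime p} (n - 1)"

(* Valued in int so that the subtraction is not truncated. *)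
definition prime_gap :: "nat \<Rightarrow> int" where
  "prime_gap n = int (nth_prime (n + 1)) - int (nth_prime n)"

lemma nth_prime_1: "nth_prime 1 = 2"
proof -
  have "(LEAST n. n \<in> {p::nat. prime p}) = 2"
    by (rule Least_equality) (auto intro: prime_ge_2_nat)
  then show ?thesis by (simp add: nth_prime_def enumerate_0)
qed

lemma prime_nth_prime: "prime (nth_prime n)"
  using enumerate_in_set[OF primes_infinite] by (simp add: nth_prime_def)

lemma nth_prime_less_Suc: "n \<ge> 1 \<Longrightarrow> nth_prime n < nth_prime (n + 1)"
  using enumerate_step[OF primes_infinite, of "n - 1"] by (simp add: nth_prime_def)

lemma nth_prime_surj: "prime p \<Longrightarrow> \<exists>n\<ge>1. nth_prime n = p"
proof -
  assume "prime p"
  then obtain k where "enumerate {p::nat. prime p} k = p"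
    using enumerate_Ex[of "{p::nat. prime p}" p] primes_infinite by auto
  then have "nth_prime (Suc k) = p" by (simp add: nth_prime_def)
  then show ?thesis by (intro exI[of _ "Suc k"]) simp
qed

end

theory Submission
  imports Defs "HOL-Computational_Algebra.Squarefree"
begin

text \<open>
  Both inequalities say that \<open>(q\<^sub>n\<^sub>+\<^sub>1 + 1) / p\<^sub>n\<^sub>+\<^sub>1 > q\<^sub>n / p\<^sub>n\<close>. If this failed from some
  index on, then \<open>1 / p\<^sub>n\<^sub>+\<^sub>1 \<le> q\<^sub>n / p\<^sub>n - q\<^sub>n\<^sub>+\<^sub>1 / p\<^sub>n\<^sub>+\<^sub>1\<close> would telescope to a bound on the
  sum of the reciprocals of the primes. That this sum diverges is shown by Erdos' argument:
  with \<open>P\<close> a finite set of primes, at most \<open>2^|P| x\<close> numbers up to \<open>x\<^sup>2\<close> have all their prime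
  factors in \<open>P\<close>, so for large \<open>x\<close> at least half of them are multiples of primes outside \<open>P\<close>.
\<close>

text \<open>Such an \<open>n\<close> is determined by the set of primes in \<open>P\<close> with odd
  exponent in \<open>n\<close>, for which there are \<open>2 ^ card P\<close> choices, and by its
  square part, which is at most \<open>x\<close> because its square divides
  \<open>n\<close>.\<close>

lemma card_prime_factors_subset_le:
  fixes P :: "nat set"
  assumes "finite P"
  shows "card {n\<in>{1..x\<^sup>2}. prime_factors n \<subseteq> P} \<le> 2 ^ card P * x"
proof -
  let ?S = "{n\<in>{1..x\<^sup>2}. prime_factors n \<subseteq> P}"
  let ?f = "\<lambda>n. ({p\<in>P. odd (multiplicity p n)}, square_part n)"
  have "inj_on ?f ?S"
  proof (rule inj_onI)
    fix m n assume m: "m \<in> ?S" and n: "n \<in> ?S" and eq: "?f m = ?f n"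
    \<comment> \<open>For \<open>p\<close> in \<open>P\<close> the exponent is recovered from its
      parity and its integer half, the latter being the exponent of \<open>p\<close> in the square
      part. Outside \<open>P\<close> both exponents vanish.\<close>
    have mult_eq: "multiplicity p m = multiplicity p n" if p: "prime p" for p
    proof (cases "p \<in> P")
      case True
      then have "odd (multiplicity p m) \<longleftrightarrow> odd (multiplicity p n)"
        using eq by auto
      moreover have "multiplicity p m div 2 = multiplicity p n div 2"
        using eq prime_multiplicity_square_part[OF p] by (metis snd_conv)
      ultimately show ?thesis
        by presburger
    next
      case False
      then have "\<not> p dvd m" "\<not> p dvd n"
        using m n p by (auto simp: prime_factors_dvd)
      then show ?thesis
        by (simp add: not_dvd_imp_multiplicity_0)
    qed
    have "m > 0" "n > 0"
      using m n by auto
    then show "m = n"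
      by (rule multiplicity_eq_nat) (rule mult_eq)
  qed
  moreover have "?f ` ?S \<subseteq> Pow P \<times> {1..x}"
  proof clarsimp
    fix n assume n: "Suc 0 \<le> n" "n \<le> x\<^sup>2"
    then have "(square_part n)\<^sup>2 \<le> x\<^sup>2"
      using dvd_imp_le[OF square_part_square_dvd, of n] by linarith
    moreover have "square_part n > 0"
      using n by (intro gr0I) simp
    ultimately show "Suc 0 \<le> square_part n \<and> square_part n \<le> x"
      by (simp add: power2_nat_le_eq_le Suc_le_eq)
  qed
  ultimately have "card ?S \<le> card (Pow P \<times> {1..x})"
    using assms by (intro card_inj_on_le) auto
  then show ?thesis
    using assms by (simp add: card_cartesian_product card_Pow)
qed

lemma card_multiples_le:
  fixes q N :: nat
  assumes "q > 0"
  shows "card {n\<in>{1..N}. q dvd n} \<le> N div q"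
proof -
  have "{n\<in>{1..N}. q dvd n} \<subseteq> (*) q ` {1..N div q}"
    using assms by (auto simp: dvd_def less_eq_div_iff_mult_less_eq mult.commute)
  then have "card {n\<in>{1..N}. q dvd n} \<le> card {1..N div q}"
    by (rule surj_card_le[rotated]) simp
  then show ?thesis
    by simp
qed

lemma sum_inverse_primes_outside_ge:
  fixes P :: "nat set"
  assumes "finite P"
  obtains Q where "finite Q" "Q \<subseteq> {p. prime p} - P" "(\<Sum>p\<in>Q. 1 / real p) \<ge> 1 / 2"
proof
  \<comment> \<open>With this choice \<open>2 ^ card P * x\<close> is exactly half of
    \<open>x\<^sup>2\<close>, so multiples of primes in \<open>Q\<close> have to account for the
    other half.\<close>
  define x :: nat where "x = 2 ^ (card P + 1)"
  define Q where "Q = {p\<in>{1..x\<^sup>2}. prime p \<and> p \<notin> P}"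
  show "finite Q" "Q \<subseteq> {p. prime p} - P"
    by (auto simp: Q_def)
  have x: "real x > 0"
    by (simp add: x_def)
  let ?A = "{n\<in>{1..x\<^sup>2}. prime_factors n \<subseteq> P}"
  let ?B = "\<Union>q\<in>Q. {n\<in>{1..x\<^sup>2}. q dvd n}"
  have "{1..x\<^sup>2} \<subseteq> ?A \<union> ?B"
  proof
    fix n assume n: "n \<in> {1..x\<^sup>2}"
    show "n \<in> ?A \<union> ?B"
    proof (cases "prime_factors n \<subseteq> P")
      case False
      then obtain p where p: "prime p" "p dvd n" "p \<notin> P"
        by (auto simp: prime_factors_dvd)
      then have "p \<in> Q"
        using n dvd_imp_le[of p n] prime_gt_0_nat[of p] by (auto simp: Q_def)
      then show ?thesis
        using n p by blast
    qed (use n in auto)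
  qed
  then have "card {1..x\<^sup>2} \<le> card (?A \<union> ?B)"
    using \<open>finite Q\<close> by (intro card_mono) auto
  also have "\<dots> \<le> card ?A + card ?B"
    by (rule card_Un_le)
  also have "card ?B \<le> (\<Sum>q\<in>Q. card {n\<in>{1..x\<^sup>2}. q dvd n})"
    by (rule card_UN_le) fact
  also have "\<dots> \<le> (\<Sum>q\<in>Q. x\<^sup>2 div q)"
    by (intro sum_mono card_multiples_le) (auto simp: Q_def)
  also have "card ?A \<le> 2 ^ card P * x"
    by (rule card_prime_factors_subset_le) fact
  finally have "real (x\<^sup>2) \<le> real (2 ^ card P * x + (\<Sum>q\<in>Q. x\<^sup>2 div q))"
    by (simp del: of_nat_add of_nat_mult of_nat_power of_nat_sum)
  also have "\<dots> = (real x)\<^sup>2 / 2 + (\<Sum>q\<in>Q. real (x\<^sup>2 div q))"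
    by (simp add: x_def power2_eq_square)
  \<comment> \<open>Dropping the floors lets \<open>x\<^sup>2\<close> factor out and cancel.\<close>
  also have "(\<Sum>q\<in>Q. real (x\<^sup>2 div q)) \<le> (\<Sum>q\<in>Q. real (x\<^sup>2) / real q)"
    by (intro sum_mono of_nat_div_le_of_nat)
  also have "\<dots> = (real x)\<^sup>2 * (\<Sum>q\<in>Q. 1 / real q)"
    by (simp add: sum_distrib_left)
  finally have "(real x)\<^sup>2 * (1 / 2) \<le> (real x)\<^sup>2 * (\<Sum>q\<in>Q. 1 / real q)"
    by simp
  then show "(\<Sum>p\<in>Q. 1 / real p) \<ge> 1 / 2"
    using x by (subst (asm) mult_le_cancel_left_pos) auto
qed

text \<open>Convergence would make the tail after some first \<open>k\<close> primes smaller than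
  1/2, yet finitely many of the remaining primes already contribute at least 1/2.\<close>

lemma not_summable_inverse_primes: "\<not> summable (\<lambda>n. 1 / real (enumerate {p::nat. prime p} n))"
proof
  define e where "e = enumerate {p::nat. prime p}"
  assume "summable (\<lambda>n. 1 / real (enumerate {p::nat. prime p} n))"
  then have summable: "summable (\<lambda>n. 1 / real (e n))"
    by (simp add: e_def)
  have range: "range e = {p. prime p}" and inj: "inj e"
    unfolding e_def using primes_infinite
    by (auto simp: range_enumerate inj_enumerate)
  obtain k where "norm (\<Sum>i. 1 / real (e (i + k))) < 1 / 2"
    using suminf_exist_split[OF _ summable, of "1 / 2"] by auto
  then have k: "(\<Sum>i. 1 / real (e (i + k))) < 1 / 2"
    by simp
  obtain Q where Q: "finite Q" "Q \<subseteq> {p. prime p} - e ` {..<k}" "(\<Sum>p\<in>Q. 1 / real p) \<ge> 1 / 2"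
    using sum_inverse_primes_outside_ge[of "e ` {..<k}"] by auto
  have "Q \<subseteq> (\<lambda>i. e (i + k)) ` UNIV"
  proof
    fix p assume p: "p \<in> Q"
    then have "p \<in> range e"
      using Q(2) range by blast
    then obtain j where j: "p = e j"
      by blast
    have "p \<notin> e ` {..<k}"
      using p Q(2) by blast
    then have "j \<ge> k"
      unfolding j by (meson imageI lessThan_iff not_le)
    then show "p \<in> (\<lambda>i. e (i + k)) ` UNIV"
      by (intro image_eqI[of _ _ "j - k"]) (auto simp: j)
  qed
  then obtain I where I: "finite I" "Q = (\<lambda>i. e (i + k)) ` I"
    using finite_subset_image[OF Q(1)] by metis
  have "(\<Sum>p\<in>Q. 1 / real p) = (\<Sum>i\<in>I. 1 / real (e (i + k)))"
    unfolding I(2) by (subst sum.reindex) (auto intro!: inj_onI dest: injD[OF inj])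
  also have "\<dots> \<le> (\<Sum>i. 1 / real (e (i + k)))"
    using summable I(1) by (intro sum_le_suminf summable_ignore_initial_segment) auto
  finally show False
    using k Q(3) by simp
qed

theorem corollary1:
  fixes q :: "nat \<Rightarrow> real"
  assumes "\<And>n. n \<ge> 1 \<Longrightarrow> q n > 0"
  shows "infinite {n. n \<ge> 1 \<and>
           real_of_int (prime_gap n) < real (nth_prime n) * ((q (n + 1) - q n + 1) / q n) \<and>
           real (nth_prime (n + 1)) / real (nth_prime n) < (q (n + 1) + 1) / q n}"
    (is "infinite ?S")
proof
  assume "finite ?S"
  then obtain N where N: "\<And>n. n \<in> ?S \<Longrightarrow> n < N"
    using finite_nat_set_iff_bounded by meson
  \<comment> \<open>The successor ensures \<open>M \<ge> 1\<close>, so that \<open>q\<close> is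
    positive from \<open>M\<close> on.\<close>
  define M where "M = Suc N"
  define r where "r n = q n / real (nth_prime n)" for n
  have pos: "real (nth_prime n) > 0" for n
    using prime_nth_prime by (simp add: prime_gt_0_nat)
  have step: "1 / real (nth_prime (n + 1)) \<le> r n - r (n + 1)" if n: "n \<ge> M" for n
  proof -
    have q: "q n > 0" and n1: "n \<ge> 1"
      using assms[of n] n by (auto simp: M_def)
    \<comment> \<open>Adding \<open>nth_prime n\<close> to both sides of (i) and dividing by it
      gives (ii). Hence an index outside the set violates both, not merely one of them.\<close>
    have iff: "real_of_int (prime_gap n) < real (nth_prime n) * ((q (n + 1) - q n + 1) / q n) \<longleftrightarrow>
        real (nth_prime (n + 1)) / real (nth_prime n) < (q (n + 1) + 1) / q n"
      using q pos[of n] by (simp add: prime_gap_def field_simps)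
    have "n \<notin> ?S"
      using N[of n] n by (auto simp: M_def)
    then have "(q (n + 1) + 1) / q n \<le> real (nth_prime (n + 1)) / real (nth_prime n)"
      using n1 iff by auto
    then show ?thesis
      using q pos[of n] pos[of "n + 1"] by (simp add: r_def field_simps)
  qed
  have "(\<Sum>i<m. 1 / real (nth_prime (i + M + 1))) \<le> r M - r (m + M)" for m
  proof (induction m)
    case (Suc m)
    then show ?case
      using step[of "m + M"] by (simp add: add.assoc)
  qed simp
  \<comment> \<open>Positivity of \<open>q\<close> makes the telescoped bound independent of
    \<open>m\<close>.\<close>
  moreover have "r M - r (m + M) \<le> r M" for m
    using assms[of "m + M"] by (simp add: r_def M_def)
  ultimately have "(\<Sum>i<m. 1 / real (nth_prime (i + M + 1))) \<le> r M" for m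
    by (rule order_trans)
  then have "summable (\<lambda>i. 1 / real (nth_prime (i + M + 1)))"
    by (intro summableI_nonneg_bounded) auto
  \<comment> \<open>Since \<open>nth_prime\<close> counts from 1 and \<open>enumerate\<close> from
    0, the index \<open>i + M + 1\<close> becomes \<open>i + M\<close>: a shift of the divergent
    series.\<close>
  then have "summable (\<lambda>i. 1 / real (enumerate {p. prime p} (i + M)))"
    by (simp add: nth_prime_def)
  then show False
    using not_summable_inverse_primes by (subst (asm) summable_iff_shift) auto
qed

end
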